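(* Let $k\geq 2$, let $B$ be a finite set, let $\mathbb{F}$ be a field, let $T:B^k\to\mathbb{F}$ be a semi-diagonal tensor, and let $w_1,\ldots,w_k\geq 0$ be real numbers. Then $$\sum_{i=1}^k w_i\,\mathrm{frank}_i(T)\ \geq\ \mathbf{w}(w_1,\ldots,w_k)\,|B|,\qquad\text{where}\qquad \mathbf{w}(w_1,\ldots,w_k)=\min_{\substack{J\subseteq\{1,\dots,k\}\\ |J|\geq 2}}\frac{\sum_{j\in J}w_j}{|J|-1}.$$
   Context: A tensor $T:B^k\to\mathbb{F}$ is semi-diagonal if $T(b,\ldots,b)\neq 0$ for every $b\in B$ and $T(b_1,\ldots,b_k)=0$ whenever $b_1,\ldots,b_k$ are all distinct (no restriction on other tuples). The $i$-flattening matrix $M_i(T)$ of $T$ has rows indexed by the $i$-th coordinate $x_i\in B$, columns indexed by the remaining coordinates $(x_j)_{j\neq i}\in B^{k-1}$, and entry $T(x_1,\ldots,x_k)$. The $i$-flattening rank is $\mathrm{frank}_i(T)=\operatorname{rank}M_i(T)$ (rank over $\mathbb{F}$). *)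

theory Defs
  imports Complex_Main "HOL-Library.FuncSet" "HOL-Library.Function_Algebras"
begin

text \<open>Scalars act pointwise on functions; addition on functions is pointwise by
  \<^theory>\<open>HOL-Library.Function_Algebras\<close>.\<close>

definition fun_scale :: "'a::field \<Rightarrow> ('r \<Rightarrow> 'a) \<Rightarrow> 'r \<Rightarrow> 'a" where
  "fun_scale a v = (\<lambda>r. a * v r)"

lemma vector_space_fun_scale: "vector_space (fun_scale :: 'a::field \<Rightarrow> ('r \<Rightarrow> 'a) \<Rightarrow> 'r \<Rightarrow> 'a)"
  by unfold_locales (simp_all add: fun_scale_def fun_eq_iff algebra_simps)

text \<open>A matrix with row index set \<open>R\<close> and column index set \<open>C\<close> is a function \<open>M\<close> of which
  only the values \<open>M r c\<close> with \<open>r \<in> R\<close> and \<open>c \<in> C\<close> matter. A column is extended by \<open>0\<close>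
  outside \<open>R\<close>, and the rank is the dimension of the column space.\<close>

definition matrix_column :: "'r set \<Rightarrow> ('r \<Rightarrow> 'c \<Rightarrow> 'a::field) \<Rightarrow> 'c \<Rightarrow> 'r \<Rightarrow> 'a" where
  "matrix_column R M c = (\<lambda>r. if r \<in> R then M r c else 0)"

definition matrix_rank :: "'r set \<Rightarrow> 'c set \<Rightarrow> ('r \<Rightarrow> 'c \<Rightarrow> 'a::field) \<Rightarrow> nat" where
  "matrix_rank R C M = vector_space.dim fun_scale (matrix_column R M ` C)"

text \<open>Elements of \<open>B\<^sup>k\<close> are the extensional functions in \<open>{1..k} \<rightarrow>\<^sub>E B\<close>, and a tensor is a
  function of which only the values on this set matter.\<close>

definition semi_diagonal :: "nat \<Rightarrow> 'b set \<Rightarrow> ((nat \<Rightarrow> 'b) \<Rightarrow> 'a::field) \<Rightarrow> bool" where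
  "semi_diagonal k B T \<longleftrightarrow>
     (\<forall>b\<in>B. T (\<lambda>j\<in>{1..k}. b) \<noteq> 0) \<and>
     (\<forall>x\<in>{1..k} \<rightarrow>\<^sub>E B. inj_on x {1..k} \<longrightarrow> T x = 0)"

definition flattening :: "nat \<Rightarrow> ((nat \<Rightarrow> 'b) \<Rightarrow> 'a::field) \<Rightarrow> 'b \<Rightarrow> (nat \<Rightarrow> 'b) \<Rightarrow> 'a" where
  "flattening i T b y = T (y(i := b))"

definition frank :: "nat \<Rightarrow> 'b set \<Rightarrow> nat \<Rightarrow> ((nat \<Rightarrow> 'b) \<Rightarrow> 'a::field) \<Rightarrow> nat" where
  "frank k B i T = matrix_rank B (({1..k} - {i}) \<rightarrow>\<^sub>E B) (flattening i T)"

definition min_weight :: "nat \<Rightarrow> (nat \<Rightarrow> real) \<Rightarrow> real" where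
  "min_weight k w =
     Min ((\<lambda>J. (\<Sum>j\<in>J. w j) / (real (card J) - 1)) ` {J. J \<subseteq> {1..k} \<and> card J \<ge> 2})"

end

theory Submission
  imports Defs "HOL-Library.Disjoint_Sets"
begin

text \<open>
  The weighted bound reduces to the unweighted bounds
  \<open>card B \<le> (\<Sum>i\<in>{1..k} - {p}. frank k B i T)\<close>, one for each position \<open>p\<close>.
  Let \<open>m\<close> be the minimal weight. Minimality, applied to the set of all \<open>j\<close> with \<open>w j < m\<close>,
  says that the deficits \<open>max 0 (m - w j)\<close> add up to at most \<open>m\<close>. For \<open>m > 0\<close>, the
  weights divided by \<open>m\<close> thus dominate a convex combination of the \<open>0\<close>-\<open>1\<close> weightings that vanish at
  exactly one position, and the claim is linear in the weights.

  For the unweighted bound, call \<open>S\<close> a detecting set for position \<open>i\<close> on \<open>B' \<subseteq> B\<close> if a column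
  of the \<open>i\<close>-flattening that is nonzero somewhere on \<open>B'\<close> is nonzero somewhere on \<open>S\<close>.
  There is such an \<open>S \<subseteq> B'\<close> with at most \<open>frank k B i T\<close> elements. Choose these sets greedily
  for all positions \<open>i \<noteq> p\<close>, each inside what the previous ones left over, so that they are
  disjoint. They cover \<open>B\<close>: if \<open>b\<close> were left over, then starting from the
  nonzero diagonal entry at \<open>(b, \<dots>, b)\<close> one could replace the coordinates \<open>i \<noteq> p\<close> one at a
  time by elements of the respective detecting sets and keep the entry nonzero. The result
  is a nonzero entry with distinct coordinates, which semi-diagonality forbids.
\<close>

section \<open>Detecting sets\<close>

interpretation fun_space: vector_space fun_scale
  by (rule vector_space_fun_scale)

lemma sum_fun_scale_apply:
  "(\<Sum>t\<in>U. fun_scale (g t) (v t)) r = (\<Sum>t\<in>U. g t * v t r)"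
  by (induction U rule: infinite_finite_induct) (simp_all add: fun_scale_def)

text \<open>Evaluation at the points of \<open>S\<close> separates the \<open>v s\<close>, so they are linearly independent.\<close>

lemma card_le_dim_of_diagonal_family:
  fixes v :: "'r \<Rightarrow> 'r \<Rightarrow> 'a::field"
  assumes "finite X" "finite S"
    and span: "\<And>s. s \<in> S \<Longrightarrow> v s \<in> fun_space.span X"
    and diag: "\<And>s. s \<in> S \<Longrightarrow> v s s \<noteq> 0"
    and off: "\<And>s t. s \<in> S \<Longrightarrow> t \<in> S \<Longrightarrow> s \<noteq> t \<Longrightarrow> v s t = 0"
  shows "card S \<le> fun_space.dim X"
proof -
  have inj: "inj_on v S"
    using diag off by (metis inj_onI)
  have indep: "fun_space.independent (v ` S)"
  proof (rule fun_space.independent_if_scalars_zero)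
    show "finite (v ` S)" using \<open>finite S\<close> by simp
  next
    fix g u
    assume zero: "(\<Sum>u\<in>v ` S. fun_scale (g u) u) = 0" and "u \<in> v ` S"
    then obtain s where s: "s \<in> S" "u = v s" by auto
    have "0 = (\<Sum>u\<in>v ` S. fun_scale (g u) u) s"
      by (simp add: zero)
    also have "\<dots> = (\<Sum>t\<in>S. g (v t) * v t s)"
      by (simp add: sum_fun_scale_apply sum.reindex[OF inj])
    also have "\<dots> = (\<Sum>t\<in>S. if t = s then g (v s) * v s s else 0)"
      using off s by (intro sum.cong) auto
    also have "\<dots> = g (v s) * v s s"
      using s \<open>finite S\<close> by simp
    finally show "g u = 0" using diag s by auto
  qed
  obtain Y where Y: "Y \<subseteq> X" "X \<subseteq> fun_space.span Y" "card Y = fun_space.dim X"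
    by (metis fun_space.basis_exists)
  have "v ` S \<subseteq> fun_space.span Y"
    using span Y(2) fun_space.span_mono fun_space.span_span by blast
  then have "card (v ` S) \<le> card Y"
    using fun_space.independent_span_bound indep Y(1) \<open>finite X\<close> finite_subset by blast
  then show ?thesis using Y(3) inj by (simp add: card_image)
qed

text \<open>
  A detecting set of minimal cardinality is small enough: since no element \<open>s\<close> can be removed,
  some \<open>v \<in> X\<close> vanishes on the rest of the detecting set but not at \<open>s\<close>, and such functions form
  a diagonal family.
\<close>

lemma ex_detecting_set:
  fixes X :: "('r \<Rightarrow> 'a::field) set"
  assumes "finite X" "finite B"
  obtains S where "S \<subseteq> B" "card S \<le> fun_space.dim X"
    "\<And>v b. v \<in> X \<Longrightarrow> b \<in> B \<Longrightarrow> v b \<noteq> 0 \<Longrightarrow> \<exists>s\<in>S. v s \<noteq> 0"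
proof -
  define separating where "separating = (\<lambda>S. S \<subseteq> B \<and>
    (\<forall>v\<in>X. (\<forall>s\<in>S. v s = 0) \<longrightarrow> (\<forall>b\<in>B. v b = 0)))"
  have "separating B" by (auto simp: separating_def)
  then obtain S where S: "separating S" and minimal: "\<And>S'. separating S' \<Longrightarrow> card S \<le> card S'"
    by (metis ex_has_least_nat)
  have "finite S" using S \<open>finite B\<close> finite_subset by (auto simp: separating_def)
  have "\<exists>v\<in>X. v s \<noteq> 0 \<and> (\<forall>t\<in>S - {s}. v t = 0)" if "s \<in> S" for s
  proof -
    have "\<not> separating (S - {s})"
      using minimal \<open>finite S\<close> that by (meson card_Diff1_less not_less)
    then obtain v where v: "v \<in> X" "\<forall>t\<in>S - {s}. v t = 0" "\<not> (\<forall>b\<in>B. v b = 0)"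
      using S unfolding separating_def by blast
    then have "v s \<noteq> 0"
      using S unfolding separating_def by (metis DiffI singletonD)
    then show ?thesis using v by blast
  qed
  then obtain v where v: "\<And>s. s \<in> S \<Longrightarrow> v s \<in> X \<and> v s s \<noteq> 0 \<and> (\<forall>t\<in>S - {s}. v s t = 0)"
    by metis
  have "card S \<le> fun_space.dim X"
    by (rule card_le_dim_of_diagonal_family[of X S v]) (use assms \<open>finite S\<close> v fun_space.span_base in auto)
  moreover have "\<exists>s\<in>S. u s \<noteq> 0" if "u \<in> X" "b \<in> B" "u b \<noteq> 0" for u b
    using S that unfolding separating_def by blast
  ultimately show thesis using that S unfolding separating_def by blast
qed

text \<open>
  The columns are always indexed by tuples over all of \<open>B\<close>; only the set \<open>B'\<close> on which they are
  tested shrinks. This is what allows the coordinates other than \<open>i\<close> to be elements of the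
  other detecting sets.
\<close>

definition detects :: "nat \<Rightarrow> 'b set \<Rightarrow> ((nat \<Rightarrow> 'b) \<Rightarrow> 'a::field) \<Rightarrow> nat \<Rightarrow> 'b set \<Rightarrow> 'b set \<Rightarrow> bool" where
  "detects k B T i S B' \<longleftrightarrow> (\<forall>y\<in>({1..k} - {i}) \<rightarrow>\<^sub>E B. \<forall>b\<in>B'.
     T (y(i := b)) \<noteq> 0 \<longrightarrow> (\<exists>s\<in>S. T (y(i := s)) \<noteq> 0))"

lemma detects_mono: "detects k B T i S B' \<Longrightarrow> B'' \<subseteq> B' \<Longrightarrow> detects k B T i S B''"
  unfolding detects_def by blast

lemma ex_frank_detecting_set:
  fixes T :: "(nat \<Rightarrow> 'b) \<Rightarrow> 'a::field"
  assumes "finite B" "B' \<subseteq> B"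
  obtains S where "S \<subseteq> B'" "card S \<le> frank k B i T" "detects k B T i S B'"
proof -
  let ?C = "({1..k} - {i}) \<rightarrow>\<^sub>E B"
  let ?X = "matrix_column B (flattening i T) ` ?C"
  have "finite ?X" using \<open>finite B\<close> by (intro finite_imageI finite_PiE) auto
  moreover have "finite B'" using assms finite_subset by blast
  ultimately obtain S where S: "S \<subseteq> B'" "card S \<le> fun_space.dim ?X"
    and det: "\<And>v b. v \<in> ?X \<Longrightarrow> b \<in> B' \<Longrightarrow> v b \<noteq> 0 \<Longrightarrow> \<exists>s\<in>S. v s \<noteq> 0"
    using ex_detecting_set[of ?X B'] by blast
  have entry: "matrix_column B (flattening i T) y b = T (y(i := b))" if "b \<in> B'" for y b
    using that assms by (auto simp: matrix_column_def flattening_def)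
  have "\<exists>s\<in>S. T (y(i := s)) \<noteq> 0" if "y \<in> ?C" "b \<in> B'" "T (y(i := b)) \<noteq> 0" for y b
    using det[of "matrix_column B (flattening i T) y" b] that entry S(1)
    by (metis imageI subsetD)
  then have "detects k B T i S B'" unfolding detects_def by blast
  then show thesis using that S by (simp add: frank_def matrix_rank_def)
qed

section \<open>The unweighted bound\<close>

text \<open>
  Each new set is chosen inside what the earlier ones leave over, which makes it disjoint from
  them. The earlier ones still detect on the smaller remainder.
\<close>

lemma ex_disjoint_detecting_sets:
  fixes T :: "(nat \<Rightarrow> 'b) \<Rightarrow> 'a::field"
  assumes "finite B" "finite I"
  shows "\<exists>S. disjoint_family_on S I \<and> (\<forall>i\<in>I. S i \<subseteq> B \<and> card (S i) \<le> frank k B i T \<and>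
    detects k B T i (S i) (B - (\<Union>j\<in>I. S j)))"
  using \<open>finite I\<close>
proof (induction I)
  case empty
  then show ?case by (simp add: disjoint_family_on_def)
next
  case (insert i I)
  from insert.IH obtain S where disj: "disjoint_family_on S I"
    and S: "\<forall>j\<in>I. S j \<subseteq> B \<and> card (S j) \<le> frank k B j T \<and>
      detects k B T j (S j) (B - (\<Union>j\<in>I. S j))"
    by (elim exE conjE)
  let ?B' = "B - (\<Union>j\<in>I. S j)"
  obtain S' where S': "S' \<subseteq> ?B'" "card S' \<le> frank k B i T" "detects k B T i S' ?B'"
    by (rule ex_frank_detecting_set[OF \<open>finite B\<close> Diff_subset])
  define R where "R = S(i := S')"
  have R: "R i = S'" "\<And>j. j \<in> I \<Longrightarrow> R j = S j"
    using \<open>i \<notin> I\<close> by (auto simp: R_def)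
  have rest: "B - (\<Union>j\<in>insert i I. R j) \<subseteq> ?B'"
    using R(2) by auto
  have "S' \<inter> (\<Union>j\<in>I. R j) = {}"
    using S'(1) R(2) by auto
  moreover have "disjoint_family_on R I"
    using disj R(2) by (simp add: disjoint_family_on_def)
  ultimately have "disjoint_family_on R (insert i I)"
    using \<open>i \<notin> I\<close> by (simp add: disjoint_family_on_insert R(1))
  moreover have "R j \<subseteq> B \<and> card (R j) \<le> frank k B j T \<and>
      detects k B T j (R j) (B - (\<Union>j\<in>insert i I. R j))" if "j \<in> insert i I" for j
  proof (cases "j = i")
    case True
    have "detects k B T i S' (B - (\<Union>j\<in>insert i I. R j))"
      using S'(3) rest by (rule detects_mono)
    then show ?thesis using True S' R(1) by blast
  next
    case False
    then have "j \<in> I" using that by blast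
    with S have Sj: "S j \<subseteq> B" "card (S j) \<le> frank k B j T" "detects k B T j (S j) ?B'"
      by simp_all
    have "detects k B T j (S j) (B - (\<Union>j\<in>insert i I. R j))"
      using Sj(3) rest by (rule detects_mono)
    then show ?thesis using Sj R(2)[OF \<open>j \<in> I\<close>] by simp
  qed
  ultimately show ?case by (intro exI[of _ R]) simp
qed

lemma card_le_sum_frank_except_one:
  fixes T :: "(nat \<Rightarrow> 'b) \<Rightarrow> 'a::field"
  assumes "finite B" and semi: "semi_diagonal k B T" and "p \<in> {1..k}"
  shows "card B \<le> (\<Sum>i\<in>{1..k} - {p}. frank k B i T)"
proof -
  let ?I = "{1..k} - {p}"
  obtain S where disj: "disjoint_family_on S ?I"
    and S_all: "\<forall>i\<in>?I. S i \<subseteq> B \<and> card (S i) \<le> frank k B i T \<and>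
      detects k B T i (S i) (B - (\<Union>j\<in>?I. S j))"
    using ex_disjoint_detecting_sets[OF \<open>finite B\<close>, of ?I k T, OF finite_Diff[OF finite_atLeastAtMost]]
    by (elim exE conjE)
  have S: "S i \<subseteq> B" "card (S i) \<le> frank k B i T"
    and det: "detects k B T i (S i) (B - (\<Union>j\<in>?I. S j))" if "i \<in> ?I" for i
    using S_all that by simp_all
  have "B \<subseteq> (\<Union>i\<in>?I. S i)"
  proof (rule ccontr)
    assume "\<not> B \<subseteq> (\<Union>i\<in>?I. S i)"
    then obtain b where b: "b \<in> B - (\<Union>i\<in>?I. S i)" by blast
    have replace: "\<exists>x\<in>{1..k} \<rightarrow>\<^sub>E B. (\<forall>i\<in>J. x i \<in> S i) \<and> (\<forall>i\<in>{1..k} - J. x i = b) \<and> T x \<noteq> 0"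
      if "finite J" "J \<subseteq> ?I" for J
      using that
    proof (induction J)
      case empty
      have "T (\<lambda>j\<in>{1..k}. b) \<noteq> 0"
        using semi b unfolding semi_diagonal_def by blast
      moreover have "(\<lambda>j\<in>{1..k}. b) \<in> {1..k} \<rightarrow>\<^sub>E B"
        using b by simp
      ultimately show ?case
        by (metis Diff_empty empty_iff restrict_apply')
    next
      case (insert i J)
      then obtain x where x: "x \<in> {1..k} \<rightarrow>\<^sub>E B" "\<forall>i\<in>J. x i \<in> S i" "\<forall>i\<in>{1..k} - J. x i = b" "T x \<noteq> 0"
        by auto
      \<comment> \<open>Column indices are extensional functions, hence undefined at the missing position.\<close>
      define y where "y = x(i := undefined)"
      have y: "y \<in> ({1..k} - {i}) \<rightarrow>\<^sub>E B"
        using x(1) by (auto simp: y_def PiE_iff extensional_def)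
      have "y(i := b) = x"
        using x(3) insert by (auto simp: y_def)
      then obtain s where s: "s \<in> S i" "T (y(i := s)) \<noteq> 0"
        using det[of i] y b x(4) insert.prems unfolding detects_def by (metis insert_subset)
      have "y(i := s) = x(i := s)" by (simp add: y_def)
      moreover have "x(i := s) \<in> {1..k} \<rightarrow>\<^sub>E B"
        using x(1) s(1) S(1) insert.prems by (auto simp: PiE_iff extensional_def)
      ultimately show ?case
        using s x insert.hyps by (intro bexI[of _ "x(i := s)"]) (auto simp: fun_upd_def)
    qed
    obtain x where x: "x \<in> {1..k} \<rightarrow>\<^sub>E B" "\<forall>i\<in>?I. x i \<in> S i" "\<forall>i\<in>{1..k} - ?I. x i = b" "T x \<noteq> 0"
      using replace[of ?I] by auto
    have "inj_on x {1..k}"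
    proof (rule inj_onI)
      fix i j assume ij: "i \<in> {1..k}" "j \<in> {1..k}" "x i = x j"
      have "x p = b" using x(3) \<open>p \<in> {1..k}\<close> by auto
      moreover have "x l \<noteq> b" if "l \<in> ?I" for l using x(2) b that by blast
      moreover have "i = j" if "i \<in> ?I" "j \<in> ?I"
        using disj x(2) ij(3) that unfolding disjoint_family_on_def by (metis IntI empty_iff)
      ultimately show "i = j" using ij by (metis DiffI singletonD)
    qed
    then show False using semi x unfolding semi_diagonal_def by blast
  qed
  then have "card B \<le> card (\<Union>i\<in>?I. S i)"
    using finite_subset[OF S(1) \<open>finite B\<close>] by (intro card_mono finite_UN_I) auto
  also have "\<dots> \<le> (\<Sum>i\<in>?I. card (S i))" by (rule card_UN_le) simp
  also have "\<dots> \<le> (\<Sum>i\<in>?I. frank k B i T)" using S(2) by (rule sum_mono)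
  finally show ?thesis .
qed

section \<open>Weights\<close>

lemma
  assumes "k \<ge> 2" and w: "\<And>i. i \<in> {1..k} \<Longrightarrow> w i \<ge> 0"
  shows min_weight_nonneg: "min_weight k w \<ge> 0"
    and min_weight_le: "J \<subseteq> {1..k} \<Longrightarrow> card J \<ge> 2 \<Longrightarrow>
      min_weight k w * (real (card J) - 1) \<le> (\<Sum>j\<in>J. w j)"
proof -
  let ?F = "{J. J \<subseteq> {1..k} \<and> card J \<ge> 2}"
  let ?q = "\<lambda>J. (\<Sum>j\<in>J. w j) / (real (card J) - 1)"
  have fin: "finite (?q ` ?F)" by (intro finite_imageI) simp
  have "{1..k} \<in> ?F" using \<open>k \<ge> 2\<close> by simp
  then have ne: "?q ` ?F \<noteq> {}" by blast
  have "?q J \<ge> 0" if "J \<in> ?F" for J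
    using that w by (intro divide_nonneg_nonneg sum_nonneg) auto
  then show "min_weight k w \<ge> 0"
    unfolding min_weight_def Min_ge_iff[OF fin ne] by blast
  assume J: "J \<subseteq> {1..k}" "card J \<ge> 2"
  then have "min_weight k w \<le> ?q J"
    unfolding min_weight_def by (intro Min_le[OF fin]) auto
  then show "min_weight k w * (real (card J) - 1) \<le> (\<Sum>j\<in>J. w j)"
    using J(2) by (simp add: field_simps)
qed

text \<open>
  Only the set \<open>J\<close> of positions with \<open>w i < min_weight k w\<close> contributes. If it has at least two
  elements, this is the defining inequality of the minimum for \<open>J\<close>; a single deficit is
  bounded because the weights are nonnegative.
\<close>

lemma sum_weight_deficits_le:
  assumes "k \<ge> 2" and w: "\<And>i. i \<in> {1..k} \<Longrightarrow> w i \<ge> 0"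
  shows "(\<Sum>i=1..k. max 0 (min_weight k w - w i)) \<le> min_weight k w"
proof -
  let ?m = "min_weight k w"
  define J where "J = {i \<in> {1..k}. w i < ?m}"
  have J: "J \<subseteq> {1..k}" "finite J" by (auto simp: J_def)
  have m: "?m \<ge> 0" using assms by (rule min_weight_nonneg)
  have "(\<Sum>i=1..k. max 0 (?m - w i)) = (\<Sum>i\<in>J. max 0 (?m - w i))"
    using J by (intro sum.mono_neutral_right) (auto simp: J_def)
  also have "\<dots> = (\<Sum>i\<in>J. ?m - w i)"
    by (intro sum.cong) (auto simp: J_def)
  also have "\<dots> = real (card J) * ?m - (\<Sum>i\<in>J. w i)"
    by (simp add: sum_subtractf)
  also have "\<dots> \<le> ?m"
  proof (cases "card J \<ge> 2")
    case True
    then show ?thesis using min_weight_le[of k w J] assms J(1) by (simp add: algebra_simps)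
  next
    case False
    then have "real (card J) * ?m \<le> 1 * ?m" using m by (intro mult_right_mono) auto
    moreover have "(\<Sum>i\<in>J. w i) \<ge> 0" using w J(1) by (intro sum_nonneg) auto
    ultimately show ?thesis by linarith
  qed
  finally show ?thesis .
qed

theorem theorem7:
  fixes k :: nat and B :: "'b set" and T :: "(nat \<Rightarrow> 'b) \<Rightarrow> 'a::field" and w :: "nat \<Rightarrow> real"
  assumes "k \<ge> 2"
    and "finite B"
    and "semi_diagonal k B T"
    and "\<And>i. i \<in> {1..k} \<Longrightarrow> w i \<ge> 0"
  shows "(\<Sum>i=1..k. w i * real (frank k B i T)) \<ge> min_weight k w * real (card B)"
proof -
  let ?m = "min_weight k w" and ?r = "\<lambda>i. real (frank k B i T)"
  let ?c = "\<lambda>i. max 0 (?m - w i)"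
  \<comment> \<open>The unweighted bound for \<open>p\<close> says that the rank at \<open>p\<close> alone is at most the excess of the
    sum of all ranks over \<open>card B\<close>.\<close>
  define slack where "slack = (\<Sum>i=1..k. ?r i) - real (card B)"
  have slack: "?r p \<le> slack" if "p \<in> {1..k}" for p
  proof -
    have "real (card B) \<le> (\<Sum>i\<in>{1..k} - {p}. ?r i)"
      using card_le_sum_frank_except_one[OF assms(2,3) that] by (metis of_nat_le_iff of_nat_sum)
    also have "\<dots> = (\<Sum>i=1..k. ?r i) - ?r p"
      using that by (simp add: sum_diff1)
    finally show ?thesis by (simp add: slack_def)
  qed
  have "slack \<ge> 0"
    using slack[of 1] \<open>k \<ge> 2\<close> of_nat_0_le_iff[of "frank k B 1 T"] by simp
  have "(\<Sum>i=1..k. ?c i * ?r i) \<le> (\<Sum>i=1..k. ?c i * slack)"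
    using slack by (intro sum_mono mult_left_mono) auto
  also have "\<dots> = (\<Sum>i=1..k. ?c i) * slack"
    by (simp add: sum_distrib_right)
  also have "\<dots> \<le> ?m * slack"
    by (intro mult_right_mono sum_weight_deficits_le assms(1,4) \<open>slack \<ge> 0\<close>)
  finally have deficit: "(\<Sum>i=1..k. ?c i * ?r i) \<le> ?m * slack" .
  have "?m * real (card B) = ?m * (\<Sum>i=1..k. ?r i) - ?m * slack"
    by (simp add: slack_def algebra_simps)
  also have "\<dots> \<le> ?m * (\<Sum>i=1..k. ?r i) - (\<Sum>i=1..k. ?c i * ?r i)"
    using deficit by simp
  also have "\<dots> = (\<Sum>i=1..k. (?m - ?c i) * ?r i)"
    by (simp add: sum_distrib_left sum_subtractf left_diff_distrib)
  also have "\<dots> \<le> (\<Sum>i=1..k. w i * ?r i)"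
    by (intro sum_mono mult_right_mono) auto
  finally show ?thesis .
qed

end
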